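(* Let $\Gamma$ be a countable group, let $(X,\mathcal{B},\mu,T)$ be a probability-preserving $\Gamma$-action, and let $A \in \mathcal{B}$ be a measurable set with $\mu(A)>0$. Suppose that $\kappa:X \to \Gamma$ is an $A$-allocation. Given a $\mathcal{B}$-measurable function $f:X\to [0,+\infty]$, define $f_\kappa:A \to [0,+\infty]$ by $$f_\kappa(x)= \sum_{y \in X \,:\, T_\kappa (y) = x} f(y).$$ Then $$\int_A f_\kappa(x)\, d\mu(x) = \int_X f(x)\, d\mu(x).$$ In particular, taking $f \equiv 1$, $$\int_A | B_\kappa(x)|\, d\mu(x) = 1.$$
   Context: A probability-preserving action $(X,\mathcal{B},\mu,T)$ of a countable group $\Gamma$ consists of a probability space $(X,\mathcal{B},\mu)$ and an action $\gamma \mapsto T_\gamma$ of $\Gamma$ on $X$ by measurable, $\mu$-preserving bijections ($T_{\gamma\gamma'}=T_\gamma T_{\gamma'}$). For $A\in\mathcal{B}$, an $A$-allocation is a measurable function $\kappa:X \to \Gamma$ such that $T_{\kappa(x)}(x) \in A$ for $\mu$-almost every $x$. Given an $A$-allocation $\kappa$, define $T_\kappa:X\to X$ by $T_\kappa(x) = T_{\kappa(x)}(x)$, and for $x \in A$ define $$B_\kappa(x) = \{ \gamma \in \Gamma : \kappa(T_\gamma^{-1}(x))=\gamma \}.$$ Here $|\cdot|$ denotes cardinality, with value $+\infty$ for infinite sets. *)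

theory Defs
  imports "HOL-Probability.Probability" "HOL-Algebra.Group_Action"
begin

text \<open>
  The locale \<^locale>\<open>group_action\<close> makes each \<open>T g\<close> a bijection of \<open>space M\<close> onto itself that takes
  the value \<^term>\<open>undefined\<close> outside \<open>space M\<close>, with \<open>T (g \<otimes>\<^bsub>G\<^esub> h) = compose (space M) (T g) (T h)\<close>.
\<close>

locale prob_preserving_action =
  prob_space M + group_action G "space M" T
  for G :: "('g, 'b) monoid_scheme" (structure) and M :: "'x measure" and T :: "'g \<Rightarrow> 'x \<Rightarrow> 'x" +
  assumes measurable_action: "g \<in> carrier G \<Longrightarrow> T g \<in> M \<rightarrow>\<^sub>M M"
    and preserves_measure: "g \<in> carrier G \<Longrightarrow> distr M M (T g) = M"

definition allocation ::
    "('g, 'b) monoid_scheme \<Rightarrow> 'x measure \<Rightarrow> ('g \<Rightarrow> 'x \<Rightarrow> 'x) \<Rightarrow> 'x set \<Rightarrow> ('x \<Rightarrow> 'g) \<Rightarrow> bool" where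
  "allocation G M T A \<kappa> \<longleftrightarrow>
     \<kappa> \<in> M \<rightarrow>\<^sub>M count_space (carrier G) \<and> (AE x in M. T (\<kappa> x) x \<in> A)"

definition alloc_map :: "('g \<Rightarrow> 'x \<Rightarrow> 'x) \<Rightarrow> ('x \<Rightarrow> 'g) \<Rightarrow> 'x \<Rightarrow> 'x" where
  "alloc_map T \<kappa> x = T (\<kappa> x) x"

definition alloc_set ::
    "('g, 'b) monoid_scheme \<Rightarrow> 'x measure \<Rightarrow> ('g \<Rightarrow> 'x \<Rightarrow> 'x) \<Rightarrow> ('x \<Rightarrow> 'g) \<Rightarrow> 'x \<Rightarrow> 'g set" where
  "alloc_set G M T \<kappa> x = {g \<in> carrier G. \<kappa> (inv_into (space M) (T g) x) = g}"

definition alloc_sum ::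
    "'x measure \<Rightarrow> ('g \<Rightarrow> 'x \<Rightarrow> 'x) \<Rightarrow> ('x \<Rightarrow> 'g) \<Rightarrow> ('x \<Rightarrow> ennreal) \<Rightarrow> 'x \<Rightarrow> ennreal" where
  "alloc_sum M T \<kappa> f x = (\<Sum>\<^sub>\<infinity>y\<in>{y \<in> space M. alloc_map T \<kappa> y = x}. f y)"

text \<open>Unlike \<^const>\<open>card\<close>, this is \<open>\<infinity>\<close> on infinite sets.\<close>

definition ennreal_card :: "'a set \<Rightarrow> ennreal" where
  "ennreal_card S = emeasure (count_space UNIV) S"

end

theory Submission
  imports Defs
begin

text \<open>
  This is the mass transport principle. A point \<open>y\<close> of the fibre of \<open>T\<^sub>\<kappa>\<close> over \<open>x\<close> is determined by
  \<open>g = \<kappa> y\<close>, namely \<open>y = T\<^sub>g\<^sup>-\<^sup>1 x\<close>, so the fibre sum is a sum over the countable group. Exchanging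
  it with the integral and substituting \<open>x = T\<^sub>g y\<close> in the \<open>g\<close>-th summand gives the integral of
  \<open>f\<close> over \<open>{y. \<kappa> y = g \<and> T\<^sub>g y \<in> A}\<close>, and these sets partition \<open>X\<close> up to a null set.
\<close>

text \<open>Turns fibre sums into integrals, so that Tonelli's theorem becomes available. In the
  infinite case an enumeration of \<open>S\<close> reduces this to sequences; every family in
  \<open>ennreal\<close> is summable, so the unordered sum agrees with the series.\<close>

lemma infsum_eq_nn_integral_count_space:
  fixes f :: "'a \<Rightarrow> ennreal"
  assumes "countable S"
  shows "(\<Sum>\<^sub>\<infinity>x\<in>S. f x) = (\<integral>\<^sup>+x. f x \<partial>count_space S)"
proof (cases "finite S")
  case True
  then show ?thesis by (simp add: nn_integral_count_space_finite)
next
  case False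
  with assms have bij: "bij_betw (from_nat_into S) UNIV S"
    by (rule bij_betw_from_nat_into)
  have "(\<Sum>\<^sub>\<infinity>x\<in>S. f x) = (\<Sum>\<^sub>\<infinity>n. f (from_nat_into S n))"
    using infsum_reindex_bij_betw[OF bij, of f] by simp
  also have "\<dots> = (\<Sum>n. f (from_nat_into S n))"
    by (intro sums_unique has_sum_imp_sums has_sum_infsum nonneg_summable_on_complete) simp
  also have "\<dots> = (\<integral>\<^sup>+n. f (from_nat_into S n) \<partial>count_space UNIV)"
    by (simp add: nn_integral_count_space_nat)
  also have "\<dots> = (\<integral>\<^sup>+x. f x \<partial>count_space S)"
    by (rule nn_integral_bij_count_space[OF bij])
  finally show ?thesis .
qed

context group_action
begin

text \<open>Identifies the set-theoretic inverse with the action of a group element, from which it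
  inherits measurability.\<close>

lemma inv_into_eq_action_inv:
  assumes "g \<in> carrier G" "x \<in> E"
  shows "inv_into E (\<phi> g) x = \<phi> (inv g) x"
proof (rule inv_into_f_eq[OF inj_prop[OF assms(1)]])
  interpret group G
    using group_hom by (rule group_hom.axioms(1))
  show "\<phi> (inv g) x \<in> E"
    using assms element_image inv_closed by blast
  have "\<phi> g (\<phi> (inv g) x) = \<phi> \<one> x"
    using assms by (simp flip: composition_rule)
  then show "\<phi> g (\<phi> (inv g) x) = x"
    using assms(2) by (simp flip: id_eq_one)
qed

end

context prob_preserving_action
begin

lemma measurable_inv_action:
  assumes "g \<in> carrier G"
  shows "inv_into (space M) (T g) \<in> M \<rightarrow>\<^sub>M M"
proof -
  interpret group G
    using group_hom by (rule group_hom.axioms(1))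
  have "T (inv g) \<in> M \<rightarrow>\<^sub>M M"
    using assms by (intro measurable_action) simp
  then show ?thesis
    by (subst measurable_cong[OF inv_into_eq_action_inv[OF assms]])
qed

text \<open>The inverse map is \<open>\<kappa>\<close>: the condition defining
  \<open>alloc_set\<close> says that \<open>\<kappa>\<close> recovers \<open>g\<close> from the
  preimage of \<open>x\<close> under \<open>T g\<close>, and injectivity of
  \<open>T (\<kappa> y)\<close> recovers \<open>y\<close> from its image.\<close>

lemma bij_betw_alloc_set_fiber:
  assumes \<kappa>: "\<kappa> \<in> space M \<rightarrow> carrier G" and x: "x \<in> space M"
  shows "bij_betw (\<lambda>g. inv_into (space M) (T g) x) (alloc_set G M T \<kappa> x)
    {y \<in> space M. alloc_map T \<kappa> y = x}"
proof (rule bij_betwI[where g = \<kappa>])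
  have inv: "inv_into (space M) (T g) x \<in> space M" "T g (inv_into (space M) (T g) x) = x"
    if "g \<in> carrier G" for g
    using surj_prop[OF that] x by (auto intro: inv_into_into f_inv_into_f)
  show "(\<lambda>g. inv_into (space M) (T g) x) \<in>
      alloc_set G M T \<kappa> x \<rightarrow> {y \<in> space M. alloc_map T \<kappa> y = x}"
    using inv by (auto simp: alloc_set_def alloc_map_def)
  have "inv_into (space M) (T (\<kappa> y)) (T (\<kappa> y) y) = y" if "y \<in> space M" for y
    using inj_prop[of "\<kappa> y"] \<kappa> that by (intro inv_into_f_f) auto
  then show "\<kappa> \<in> {y \<in> space M. alloc_map T \<kappa> y = x} \<rightarrow> alloc_set G M T \<kappa> x"
    and "\<And>y. y \<in> {y \<in> space M. alloc_map T \<kappa> y = x} \<Longrightarrow>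
      inv_into (space M) (T (\<kappa> y)) x = y"
    using \<kappa> by (auto simp: alloc_set_def alloc_map_def)
qed (simp add: alloc_set_def)

lemma alloc_sum_eq_nn_integral_alloc_set:
  assumes "countable (carrier G)" "\<kappa> \<in> space M \<rightarrow> carrier G" "x \<in> space M"
  shows "alloc_sum M T \<kappa> f x =
    (\<integral>\<^sup>+g. f (inv_into (space M) (T g) x) \<partial>count_space (alloc_set G M T \<kappa> x))"
proof -
  have "countable (alloc_set G M T \<kappa> x)"
    using assms(1) by (rule countable_subset[rotated]) (auto simp: alloc_set_def)
  then show ?thesis
    using infsum_reindex_bij_betw[OF bij_betw_alloc_set_fiber[OF assms(2,3)], of f]
    by (simp add: alloc_sum_def infsum_eq_nn_integral_count_space)
qed

text \<open>The set \<open>alloc_set G M T \<kappa> x\<close> varies with \<open>x\<close>. Encoding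
  membership as an indicator factor, which is 1 on this set and 0 elsewhere in the group, gives a
  fixed index set, as needed for measurability in \<open>x\<close> and for exchanging
  integrals.\<close>

lemma alloc_sum_eq_nn_integral:
  assumes "countable (carrier G)" "\<kappa> \<in> space M \<rightarrow> carrier G" "x \<in> space M"
  shows "alloc_sum M T \<kappa> f x = (\<integral>\<^sup>+g. f (inv_into (space M) (T g) x) *
    indicator {g} (\<kappa> (inv_into (space M) (T g) x)) \<partial>count_space (carrier G))"
proof -
  have "alloc_sum M T \<kappa> f x = (\<integral>\<^sup>+g. f (inv_into (space M) (T g) x) *
      indicator {g} (\<kappa> (inv_into (space M) (T g) x)) \<partial>count_space (alloc_set G M T \<kappa> x))"
    unfolding alloc_sum_eq_nn_integral_alloc_set[OF assms]
    by (intro nn_integral_cong) (simp add: alloc_set_def)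
  also have "\<dots> = (\<integral>\<^sup>+g. f (inv_into (space M) (T g) x) *
      indicator {g} (\<kappa> (inv_into (space M) (T g) x)) \<partial>count_space (carrier G))"
    by (rule nn_integral_count_space_eq) (auto simp: alloc_set_def)
  finally show ?thesis .
qed

text \<open>Integrating 1 against counting measure yields the cardinality, infinite values included;
  this makes the second claim the case \<open>f = 1\<close> of the first.\<close>

lemma ennreal_card_alloc_set:
  assumes "countable (carrier G)" "\<kappa> \<in> space M \<rightarrow> carrier G" "x \<in> space M"
  shows "ennreal_card (alloc_set G M T \<kappa> x) = alloc_sum M T \<kappa> (\<lambda>_. 1) x"
  unfolding alloc_sum_eq_nn_integral_alloc_set[OF assms]
  by (simp add: ennreal_card_def emeasure_count_space)

lemma
  assumes count: "countable (carrier G)" and A [measurable]: "A \<in> sets M"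
    and alloc: "allocation G M T A \<kappa>" and f [measurable]: "f \<in> borel_measurable M"
  shows borel_measurable_alloc_sum: "alloc_sum M T \<kappa> f \<in> borel_measurable M"
    and nn_integral_alloc_sum: "(\<integral>\<^sup>+x\<in>A. alloc_sum M T \<kappa> f x \<partial>M) = (\<integral>\<^sup>+x. f x \<partial>M)"
proof -
  let ?h = "\<lambda>g x. f (inv_into (space M) (T g) x) * indicator {g} (\<kappa> (inv_into (space M) (T g) x))"
  have \<kappa> [measurable]: "\<kappa> \<in> M \<rightarrow>\<^sub>M count_space (carrier G)"
    and ae: "AE x in M. T (\<kappa> x) x \<in> A"
    using alloc by (auto simp: allocation_def)
  have \<kappa>_space: "\<kappa> \<in> space M \<rightarrow> carrier G"
    using measurable_space[OF \<kappa>] by auto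
  have h [measurable]: "?h g \<in> borel_measurable M" if "g \<in> carrier G" for g
  proof -
    note measurable_inv_action[OF that, measurable]
    have [measurable]: "indicator {g} \<in> count_space (carrier G) \<rightarrow>\<^sub>M (borel :: ennreal measure)"
      by simp
    show ?thesis by measurable
  qed
  interpret carrier: sigma_finite_measure "count_space (carrier G)"
    using count by (rule sigma_finite_measure_count_space_countable)
  have "(\<lambda>x. \<integral>\<^sup>+g. ?h g x \<partial>count_space (carrier G)) \<in> borel_measurable M"
  proof (rule carrier.borel_measurable_nn_integral)
    \<comment> \<open>Joint measurability follows from measurability of each section
      \<open>?h g\<close>, because \<open>g\<close> ranges over a countable discrete space.\<close>
    show "(\<lambda>(x, g). ?h g x) \<in> borel_measurable (M \<Otimes>\<^sub>M count_space (carrier G))"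
      unfolding case_prod_beta
      by (rule measurable_compose_countable'[where f = "\<lambda>g p. ?h g (fst p)" and g = snd and I = "carrier G"])
        (auto simp: count intro: measurable_compose[OF measurable_fst h])
  qed
  then show "alloc_sum M T \<kappa> f \<in> borel_measurable M"
    by (subst measurable_cong[OF alloc_sum_eq_nn_integral[OF count \<kappa>_space]])
  have "(\<integral>\<^sup>+x\<in>A. alloc_sum M T \<kappa> f x \<partial>M) =
      (\<integral>\<^sup>+x. (\<integral>\<^sup>+g. ?h g x * indicator A x \<partial>count_space (carrier G)) \<partial>M)"
    by (intro nn_integral_cong)
      (simp add: alloc_sum_eq_nn_integral[OF count \<kappa>_space] nn_integral_multc)
  also have "\<dots> = (\<integral>\<^sup>+g. (\<integral>\<^sup>+x. ?h g x * indicator A x \<partial>M) \<partial>count_space (carrier G))"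
    by (rule nn_integral_count_space_nn_integral[OF count]) measurable
  also have "\<dots> = (\<integral>\<^sup>+g. (\<integral>\<^sup>+y. f y * indicator {g} (\<kappa> y) * indicator A (T g y) \<partial>M) \<partial>count_space (carrier G))"
  proof (rule nn_integral_cong)
    fix g assume "g \<in> space (count_space (carrier G))"
    then have g: "g \<in> carrier G" by simp
    note h[OF g, measurable]
    \<comment> \<open>Invariance allows \<open>M\<close> to be read as its own image under
      \<open>T g\<close>. The change of variables then composes \<open>T g\<close> with its inverse
      inside \<open>?h g\<close>, and the two cancel on \<open>space M\<close>.\<close>
    have "(\<integral>\<^sup>+x. ?h g x * indicator A x \<partial>M) = (\<integral>\<^sup>+x. ?h g x * indicator A x \<partial>distr M M (T g))"
      by (simp add: preserves_measure[OF g])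
    also have "\<dots> = (\<integral>\<^sup>+y. ?h g (T g y) * indicator A (T g y) \<partial>M)"
      by (rule nn_integral_distr[OF measurable_action[OF g]]) measurable
    also have "\<dots> = (\<integral>\<^sup>+y. f y * indicator {g} (\<kappa> y) * indicator A (T g y) \<partial>M)"
      by (intro nn_integral_cong) (simp add: inv_into_f_f[OF inj_prop[OF g]])
    finally show "(\<integral>\<^sup>+x. ?h g x * indicator A x \<partial>M) = \<dots>" .
  qed
  also have "\<dots> = (\<integral>\<^sup>+y. (\<integral>\<^sup>+g. f y * indicator {g} (\<kappa> y) * indicator A (T g y) \<partial>count_space (carrier G)) \<partial>M)"
  proof (rule nn_integral_count_space_nn_integral[OF count, symmetric])
    fix g assume g: "g \<in> carrier G"
    note measurable_action[OF g, measurable]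
    have [measurable]: "indicator {g} \<in> count_space (carrier G) \<rightarrow>\<^sub>M (borel :: ennreal measure)"
      by simp
    show "(\<lambda>y. f y * indicator {g} (\<kappa> y) * indicator A (T g y)) \<in> borel_measurable M"
      by measurable
  qed
  also have "\<dots> = (\<integral>\<^sup>+y. f y \<partial>M)"
  proof (rule nn_integral_cong_AE, use ae AE_space in eventually_elim)
    case (elim y)
    \<comment> \<open>Only the term \<open>g = \<kappa> y\<close> survives, and
      \<open>y \<in> space M\<close> ensures that it lies in the group. Its factor
      \<open>indicator A\<close> is 1 for almost every \<open>y\<close> by the allocation
      property.\<close>
    have "(\<integral>\<^sup>+g. f y * indicator {g} (\<kappa> y) * indicator A (T g y) \<partial>count_space (carrier G)) =
        (\<integral>\<^sup>+g. f y * indicator {g} (\<kappa> y) * indicator A (T g y) \<partial>count_space {\<kappa> y})"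
      using \<kappa>_space elim(2) by (intro nn_integral_count_space_eq) auto
    then show ?case
      using elim(1) by (simp add: nn_integral_count_space_finite)
  qed
  finally show "(\<integral>\<^sup>+x\<in>A. alloc_sum M T \<kappa> f x \<partial>M) = (\<integral>\<^sup>+x. f x \<partial>M)" .
qed

end

theorem proposition1p3:
  fixes G :: "('g, 'b) monoid_scheme" and M :: "'x measure"
    and T :: "'g \<Rightarrow> 'x \<Rightarrow> 'x" and A :: "'x set" and \<kappa> :: "'x \<Rightarrow> 'g"
  assumes "countable (carrier G)"
    and "prob_preserving_action G M T"
    and "A \<in> sets M" and "emeasure M A > 0"
    and "allocation G M T A \<kappa>"
  shows "(\<forall>f \<in> borel_measurable M.
            alloc_sum M T \<kappa> f \<in> borel_measurable (restrict_space M A) \<and>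
            (\<integral>\<^sup>+x\<in>A. alloc_sum M T \<kappa> f x \<partial>M) = (\<integral>\<^sup>+x. f x \<partial>M)) \<and>
         (\<lambda>x. ennreal_card (alloc_set G M T \<kappa> x)) \<in> borel_measurable (restrict_space M A) \<and>
         (\<integral>\<^sup>+x\<in>A. ennreal_card (alloc_set G M T \<kappa> x) \<partial>M) = 1"
proof -
  interpret prob_preserving_action G M T by fact
  note sum = borel_measurable_alloc_sum[OF assms(1,3,5)] nn_integral_alloc_sum[OF assms(1,3,5)]
  have "\<kappa> \<in> space M \<rightarrow> carrier G"
    using assms(5) by (auto simp: allocation_def dest: measurable_space)
  note card = ennreal_card_alloc_set[OF assms(1) this]
  \<comment> \<open>The cardinality formula holds at every point of \<open>space M\<close>, so
    measurability is obtained on the whole space and restricted to \<open>A\<close> at the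
    end.\<close>
  have "(\<lambda>x. ennreal_card (alloc_set G M T \<kappa> x)) \<in> borel_measurable M"
    by (subst measurable_cong[OF card]) (simp_all add: sum(1))
  moreover have "(\<integral>\<^sup>+x\<in>A. ennreal_card (alloc_set G M T \<kappa> x) \<partial>M) =
      (\<integral>\<^sup>+x\<in>A. alloc_sum M T \<kappa> (\<lambda>_. 1) x \<partial>M)"
    by (intro nn_integral_cong) (simp add: card)
  moreover have "\<dots> = 1"
    by (simp add: sum(2) emeasure_space_1)
  ultimately show ?thesis
    by (simp add: sum measurable_restrict_space1)
qed

end
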